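(* Let $(A,C)$ be observable with observability index $\ell$, and let all eigenvalues of $S$ belong to $\{z\in\mathbb{C}:|z|\ge1\}$. For each $(\hat w,\hat x,\hat\chi)\in\mathbb{R}^{n_w}\times\mathbb{R}^n\times\mathbb{R}^{(p+m)\ell}$ and each sequence $\{u(k)\}_{k=0}^\infty$ in $\mathbb{R}^m$, there exists $\hat\xi\in\mathbb{R}^{(p+m)\ell}$ such that: - the solution $(w(\cdot),x(\cdot),\chi(\cdot))$ to $$w^+=Sw,\quad x^+=Ax+Bu+Pw,\quad \chi^+=\mathbf F\chi+\mathbf Ly+\mathbf Bu,\quad y=Cx+Qw$$ with initial condition $(w(0),x(0),\chi(0))=(\hat w,\hat x,\hat\chi)$ and input $\{u(k)\}_{k=0}^\infty$, and the corresponding output response $y(\cdot)=Cx(\cdot)+Qw(\cdot)$; and - the solution $(\omega(\cdot),\xi(\cdot))$ to $$\omega^+=S\omega,\quad \xi^+=\mathbf A\xi+\mathbf Bv+\mathbf LZ_2\mathbf S\omega$$ with initial condition at time $\ell$ equal to $(\omega(\ell),\xi(\ell))=(S^\ell\hat w,\hat\xi)$ and input $\{v(k)\}_{k=\ell}^\infty=\{u(k)\}_{k=\ell}^\infty$, and the corresponding output response $\varphi(\cdot)=Z_1\xi(\cdot)+Z_2\mathbf S\omega(\cdot)$ satisfy, for each $k\ge\ell$, $$\xi(k)=\big(y(k-\ell),\dots,y(k-1),u(k-\ell),\dots,u(k-1)\big)=\chi(k),\qquad \varphi(k)=y(k).$$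
   Context: All vectors and matrices are real. $x^+$ denotes the value of $x$ at the next time step (discrete time); $(x_1,\dots,x_k)$ denotes the stacked column vector. Dimensions: $w,\omega\in\mathbb{R}^{n_w}$, $x\in\mathbb{R}^n$, $u,v\in\mathbb{R}^m$, $y,\varphi\in\mathbb{R}^p$, $\chi,\xi\in\mathbb{R}^{(p+m)\ell}$; $A,B,P,C,Q,S$ are matrices of compatible sizes. Observability index: if $(A,C)$ is observable, $\ell$ is the smallest integer $l\ge1$ such that the stacked matrix with block rows $C,CA,\dots,CA^{l-1}$ has rank $n$. Matrices: $\mathcal O$ is the matrix with block rows $C,CA,\dots,CA^{\ell-1}$ and $\mathcal O^{\mathrm L}$ is a (fixed) left inverse, $\mathcal O^{\mathrm L}\mathcal O=I_n$. $\mathcal T_{\mathrm u}\in\mathbb{R}^{p\ell\times m\ell}$ has $(i,j)$ block $CA^{i-j-1}B$ for $i>j$ and $0$ for $i\le j$; $\mathcal T_{\mathrm w}\in\mathbb{R}^{p\ell\times n_w\ell}$ has $(i,j)$ block $CA^{i-j-1}P$ for $i>j$, $Q$ for $i=j$, $0$ for $i<j$ ($1\le i,j\le\ell$). $\mathcal R_{\mathrm u}:=[A^{\ell-1}B\ \cdots\ AB\ B]$, $\mathcal R_{\mathrm w}:=[A^{\ell-1}P\ \cdots\ AP\ P]$. $Z_1:=[\,CA^\ell\mathcal O^{\mathrm L}\ \ \ C\mathcal R_{\mathrm u}-CA^\ell\mathcal O^{\mathrm L}\mathcal T_{\mathrm u}\,]$, $Z_2:=[\,C\mathcal R_{\mathrm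 w}-CA^\ell\mathcal O^{\mathrm L}\mathcal T_{\mathrm w}\ \ \ Q\,]$. $\mathbf S$ is the matrix with block rows $S^{-\ell},S^{-\ell+1},\dots,S^{-1},I_{n_w}$ ($S$ is invertible under the eigenvalue assumption). On $\mathbb{R}^{(p+m)\ell}$, with vectors partitioned as $(a_1,\dots,a_\ell,b_1,\dots,b_\ell)$, $a_i\in\mathbb{R}^p$, $b_i\in\mathbb{R}^m$: $\mathbf F$ is the matrix of $(a_1,\dots,a_\ell,b_1,\dots,b_\ell)\mapsto(a_2,\dots,a_\ell,0,b_2,\dots,b_\ell,0)$; $\mathbf L\in\mathbb{R}^{(p+m)\ell\times p}$ is the matrix of $a\mapsto(0,\dots,0,a,0,\dots,0)$ with $a$ in position $a_\ell$; $\mathbf B\in\mathbb{R}^{(p+m)\ell\times m}$ is the matrix of $b\mapsto(0,\dots,0,b)$ with $b$ in position $b_\ell$. $\mathbf A:=\mathbf F+\mathbf LZ_1$. *)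

theory Defs
  imports "Jordan_Normal_Form.DL_Rank" "Jordan_Normal_Form.Gauss_Jordan_Elimination"
    "Jordan_Normal_Form.Char_Poly" Complex_Main
begin

(* All block indices are zero-based: block (i,j) here is block (i+1,j+1) in the usual
   one-based numbering. *)

text \<open>Grid of \<open>k \<times> l\<close> blocks \<open>f i j\<close>, each of size \<open>r \<times> c\<close>.\<close>

definition block_mat :: "nat \<Rightarrow> nat \<Rightarrow> nat \<Rightarrow> nat \<Rightarrow> (nat \<Rightarrow> nat \<Rightarrow> real mat) \<Rightarrow> real mat" where
  "block_mat k l r c f = mat (k * r) (l * c) (\<lambda>(i, j). f (i div r) (j div c) $$ (i mod r, j mod c))"

definition stack_vec :: "nat \<Rightarrow> nat \<Rightarrow> (nat \<Rightarrow> real vec) \<Rightarrow> real vec" where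
  "stack_vec k r f = vec (k * r) (\<lambda>i. f (i div r) $ (i mod r))"

definition append_cols :: "real mat \<Rightarrow> real mat \<Rightarrow> real mat" where
  "append_cols M N = four_block_mat M N (0\<^sub>m 0 (dim_col M)) (0\<^sub>m 0 (dim_col N))"

text \<open>Distinct initial states of \<open>x\<^sup>+ = A x\<close>, \<open>y = C x\<close> produce distinct output sequences.\<close>

definition observable :: "real mat \<Rightarrow> real mat \<Rightarrow> bool" where
  "observable A C \<longleftrightarrow>
    (\<forall>x \<in> carrier_vec (dim_row A). \<forall>x' \<in> carrier_vec (dim_row A).
      (\<forall>k. C *\<^sub>v (A ^\<^sub>m k *\<^sub>v x) = C *\<^sub>v (A ^\<^sub>m k *\<^sub>v x')) \<longrightarrow> x = x')"

definition obs_mat :: "real mat \<Rightarrow> real mat \<Rightarrow> nat \<Rightarrow> real mat" where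
  "obs_mat A C l = block_mat l 1 (dim_row C) (dim_row A) (\<lambda>i _. C * A ^\<^sub>m i)"

text \<open>The first argument of \<^const>\<open>vec_space.rank\<close> is the number of rows.\<close>

definition obs_index :: "real mat \<Rightarrow> real mat \<Rightarrow> nat" where
  "obs_index A C =
    (LEAST l. 1 \<le> l \<and> vec_space.rank (l * dim_row C) (obs_mat A C l) = dim_row A)"

definition Tu_mat :: "real mat \<Rightarrow> real mat \<Rightarrow> real mat \<Rightarrow> nat \<Rightarrow> real mat" where
  "Tu_mat A B C l = block_mat l l (dim_row C) (dim_col B)
    (\<lambda>i j. if j < i then C * A ^\<^sub>m (i - j - 1) * B else 0\<^sub>m (dim_row C) (dim_col B))"

definition Tw_mat :: "real mat \<Rightarrow> real mat \<Rightarrow> real mat \<Rightarrow> real mat \<Rightarrow> nat \<Rightarrow> real mat" where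
  "Tw_mat A P C Q l = block_mat l l (dim_row C) (dim_col P)
    (\<lambda>i j. if j < i then C * A ^\<^sub>m (i - j - 1) * P
           else if i = j then Q
           else 0\<^sub>m (dim_row C) (dim_col P))"

text \<open>\<open>[A\<^bsup>l-1\<^esup> M \<dots> A M M]\<close>\<close>

definition R_mat :: "real mat \<Rightarrow> real mat \<Rightarrow> nat \<Rightarrow> real mat" where
  "R_mat A M l = block_mat 1 l (dim_row A) (dim_col M) (\<lambda>_ j. A ^\<^sub>m (l - 1 - j) * M)"

definition Z1_mat :: "real mat \<Rightarrow> real mat \<Rightarrow> real mat \<Rightarrow> nat \<Rightarrow> real mat \<Rightarrow> real mat" where
  "Z1_mat A B C l OL = append_cols
    (C * A ^\<^sub>m l * OL)
    (C * R_mat A B l - C * A ^\<^sub>m l * OL * Tu_mat A B C l)"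

definition Z2_mat :: "real mat \<Rightarrow> real mat \<Rightarrow> real mat \<Rightarrow> real mat \<Rightarrow> nat \<Rightarrow> real mat \<Rightarrow> real mat" where
  "Z2_mat A P C Q l OL = append_cols
    (C * R_mat A P l - C * A ^\<^sub>m l * OL * Tw_mat A P C Q l)
    Q"

text \<open>Block rows \<open>S\<^bsup>-l\<^esup>, \<dots>, S\<^bsup>-1\<^esup>, I\<close>. For a singular \<open>S\<close> the value is unspecified.\<close>

definition S_stack :: "real mat \<Rightarrow> nat \<Rightarrow> real mat" where
  "S_stack S l = block_mat (l + 1) 1 (dim_row S) (dim_row S)
    (\<lambda>i _. the (mat_inverse S) ^\<^sub>m (l - i))"

text \<open>Matrix of \<open>(a\<^sub>1, \<dots>, a\<^sub>l) \<mapsto> (a\<^sub>2, \<dots>, a\<^sub>l, 0)\<close> with \<open>a\<^sub>i\<close> of dimension \<open>d\<close>.\<close>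

definition shift_mat :: "nat \<Rightarrow> nat \<Rightarrow> real mat" where
  "shift_mat d l = block_mat l l d d (\<lambda>i j. if j = i + 1 then 1\<^sub>m d else 0\<^sub>m d d)"

text \<open>Matrix of \<open>a \<mapsto> (0, \<dots>, 0, a)\<close> with \<open>a\<close> of dimension \<open>d\<close> and \<open>l\<close> blocks in the image.\<close>

definition last_mat :: "nat \<Rightarrow> nat \<Rightarrow> real mat" where
  "last_mat d l = block_mat l 1 d d (\<lambda>i _. if i + 1 = l then 1\<^sub>m d else 0\<^sub>m d d)"

definition F_mat :: "nat \<Rightarrow> nat \<Rightarrow> nat \<Rightarrow> real mat" where
  "F_mat p m l = four_block_mat
    (shift_mat p l) (0\<^sub>m (l * p) (l * m))
    (0\<^sub>m (l * m) (l * p)) (shift_mat m l)"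

definition L_mat :: "nat \<Rightarrow> nat \<Rightarrow> nat \<Rightarrow> real mat" where
  "L_mat p m l = last_mat p l @\<^sub>r 0\<^sub>m (l * m) p"

definition B_mat :: "nat \<Rightarrow> nat \<Rightarrow> nat \<Rightarrow> real mat" where
  "B_mat p m l = 0\<^sub>m (l * p) m @\<^sub>r last_mat m l"

definition A_mat :: "real mat \<Rightarrow> real mat \<Rightarrow> real mat \<Rightarrow> nat \<Rightarrow> real mat \<Rightarrow> real mat" where
  "A_mat A B C l OL =
    F_mat (dim_row C) (dim_col B) l + L_mat (dim_row C) (dim_col B) l * Z1_mat A B C l OL"

text \<open>\<open>(y(k-l), \<dots>, y(k-1), u(k-l), \<dots>, u(k-1))\<close>, meaningful for \<open>k \<ge> l\<close> only
  (natural-number subtraction).\<close>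

definition past_data ::
  "nat \<Rightarrow> nat \<Rightarrow> nat \<Rightarrow> (nat \<Rightarrow> real vec) \<Rightarrow> (nat \<Rightarrow> real vec) \<Rightarrow> nat \<Rightarrow> real vec" where
  "past_data p m l y u k =
    stack_vec l p (\<lambda>i. y (k - l + i)) @\<^sub>v stack_vec l m (\<lambda>i. u (k - l + i))"

end

theory Submission
  imports Defs
begin

text \<open>
  The last \<open>l\<close> inputs and outputs, together with the exosystem trajectory, determine the current
  output, and the matrices \<open>Z\<^sub>1\<close>, \<open>Z\<^sub>2\<close> are the formula for it. Write the plant over a window
  \<open>s, \<dots>, s + l - 1\<close>. The stacked outputs \<open>Y\<close>, inputs \<open>U\<close> and exosystem states \<open>W\<close> satisfy
  \<open>Y = O x(s) + T\<^sub>u U + T\<^sub>w W\<close>, and the next state is \<open>x(s + l) = A\<^sup>l x(s) + R\<^sub>u U + R\<^sub>w W\<close>.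
  Applying the left inverse \<open>O\<^sup>L\<close> recovers \<open>x(s)\<close> from the first equation; substitution into the
  second, followed by \<open>C\<close> and the feedthrough \<open>Q w(s + l)\<close>, gives
  \<open>y(s + l) = Z\<^sub>1 (Y, U) + Z\<^sub>2 (W, w(s + l))\<close> (lemma \<open>output_from_window\<close>). No eigenvalue of \<open>S\<close>
  is zero, so the exosystem can be run backwards and \<open>(W, w(s + l))\<close> is the image of the single vector
  \<open>w(s + l)\<close> under the matrix of stacked inverse powers of \<open>S\<close> (lemma \<open>S_stack_mult_vec\<close>).

  The triple \<open>F\<close>, \<open>L\<close>, \<open>B\<close> is a pair of shift registers of length \<open>l\<close>, one fed by the
  output and one by the input. Hence after \<open>l\<close> steps the state \<open>\<chi>\<close> is exactly the window of past
  data, whatever it was at time \<open>0\<close> (lemma \<open>shift_register_forgets_initial_state\<close>). The system for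
  \<open>\<xi>\<close> is the same pair of registers in which the measured output is replaced by its prediction
  \<open>Z\<^sub>1 \<xi> + Z\<^sub>2 S \<omega>\<close>. If \<open>\<xi>\<close> starts at time \<open>l\<close> from the true window, then every prediction is
  the true output, so by induction \<open>\<xi>\<close> remains the true window.
\<close>


section \<open>Block matrices and stacked vectors\<close>

lemma sum_lessThan_blocks:
  fixes g :: "nat \<Rightarrow> 'a :: comm_monoid_add"
  shows "(\<Sum>t<l * c. g t) = (\<Sum>j<l. \<Sum>b<c. g (j * c + b))"
proof -
  have "(\<Sum>t<l * c. g t) = (\<Sum>j<l. sum g {j * c..<j * c + c})"
    by (rule sum.nat_group[symmetric])
  also have "\<dots> = (\<Sum>j<l. \<Sum>b<c. g (j * c + b))"
  proof (rule sum.cong[OF refl])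
    fix j
    show "sum g {j * c..<j * c + c} = (\<Sum>b<c. g (j * c + b))"
      using sum.shift_bounds_nat_ivl[of g 0 "j * c" c]
      by (simp only: add_0 add_0_right add.commute[of c] add.commute[of _ "j * c"] atLeast0LessThan)
  qed
  finally show ?thesis .
qed

lemma block_index_less: "a < r \<Longrightarrow> i < k \<Longrightarrow> i * r + a < k * (r :: nat)"
proof -
  assume "a < r" "i < k"
  then have "i * r + a < Suc i * r" by simp
  also have "\<dots> \<le> k * r" using \<open>i < k\<close> by (intro mult_le_mono1) simp
  finally show ?thesis .
qed

lemma stack_vec_carrier [simp]: "stack_vec k r f \<in> carrier_vec (k * r)"
  by (simp add: stack_vec_def)

lemma dim_stack_vec [simp]: "dim_vec (stack_vec k r f) = k * r"
  by (simp add: stack_vec_def)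

lemma stack_vec_index: "i < k \<Longrightarrow> a < r \<Longrightarrow> stack_vec k r f $ (i * r + a) = f i $ a"
  by (simp add: stack_vec_def block_index_less)

lemma block_indexE:
  assumes "t < k * (r :: nat)"
  obtains i a where "i < k" "a < r" "t = i * r + a"
proof (rule that[of "t div r" "t mod r"])
  show "t div r < k" using assms by (simp add: less_mult_imp_div_less)
  show "t mod r < r" using assms by (cases "r = 0") auto
qed simp

text \<open>Equality with a stacked vector is tested entry by entry in block coordinates; this keeps
  \<open>div\<close> and \<open>mod\<close> out of all later arguments.\<close>

lemma eq_stack_vecI:
  assumes "v \<in> carrier_vec (k * r)"
    and "\<And>i a. i < k \<Longrightarrow> a < r \<Longrightarrow> v $ (i * r + a) = f i $ a"
  shows "v = stack_vec k r f"
proof (rule eq_vecI)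
  fix t assume "t < dim_vec (stack_vec k r f)"
  then have "t < k * r" by simp
  then obtain i a where "i < k" "a < r" "t = i * r + a" by (rule block_indexE)
  then show "v $ t = stack_vec k r f $ t" by (simp add: assms(2) stack_vec_index)
qed (use assms(1) in simp)

lemma stack_vec_cong:
  "(\<And>i. i < k \<Longrightarrow> f i = g i) \<Longrightarrow> stack_vec k r f = stack_vec k r g"
  by (rule eq_stack_vecI) (simp_all add: stack_vec_index)

lemma stack_vec_add:
  assumes "\<And>i. i < k \<Longrightarrow> f i \<in> carrier_vec r" "\<And>i. i < k \<Longrightarrow> g i \<in> carrier_vec r"
  shows "stack_vec k r f + stack_vec k r g = stack_vec k r (\<lambda>i. f i + g i)"
proof (rule eq_stack_vecI)
  fix i a assume "i < k" "a < r"
  moreover have "dim_vec (g i) = r" using assms(2)[OF \<open>i < k\<close>] by simp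
  ultimately show "(stack_vec k r f + stack_vec k r g) $ (i * r + a) = (f i + g i) $ a"
    by (simp add: stack_vec_index block_index_less)
qed (rule add_carrier_vec[OF stack_vec_carrier stack_vec_carrier])

lemma stack_vec_Suc:
  assumes "f l \<in> carrier_vec r"
  shows "stack_vec (l + 1) r f = stack_vec l r f @\<^sub>v f l"
proof (rule eq_stack_vecI[symmetric])
  show "stack_vec l r f @\<^sub>v f l \<in> carrier_vec ((l + 1) * r)"
    using append_carrier_vec[OF stack_vec_carrier assms] by (simp add: add.commute)
  fix i a assume i: "i < l + 1" and a: "a < r"
  show "(stack_vec l r f @\<^sub>v f l) $ (i * r + a) = f i $ a"
  proof (cases "i < l")
    case True
    then show ?thesis
      using stack_vec_index[OF True a, of f] block_index_less[OF a True] assms by simp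
  next
    case False
    then have "i = l" using i by simp
    moreover have "dim_vec (f l) = r" using assms by simp
    ultimately show ?thesis using a by simp
  qed
qed

lemma stack_vec_of_vec:
  assumes "v \<in> carrier_vec (l * r)"
  shows "stack_vec l r (\<lambda>i. vec r (\<lambda>a. v $ (i * r + a))) = v"
  by (rule eq_stack_vecI[symmetric]) (use assms in auto)

lemma block_mat_carrier [simp]: "block_mat k l r c f \<in> carrier_mat (k * r) (l * c)"
  by (simp add: block_mat_def)

lemma dim_block_mat [simp]:
  "dim_row (block_mat k l r c f) = k * r" "dim_col (block_mat k l r c f) = l * c"
  by (simp_all add: block_mat_def)

text \<open>The blocks of the product are asked for entrywise, as a sum of reals, so that no sum of vectors
  (which would have to carry its dimension) is needed.\<close>

lemma block_mat_mult_stack_vec: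
  assumes f: "\<And>i j. i < k \<Longrightarrow> j < l \<Longrightarrow> f i j \<in> carrier_mat r c"
    and g: "\<And>j. j < l \<Longrightarrow> g j \<in> carrier_vec c"
    and h: "\<And>i a. i < k \<Longrightarrow> a < r \<Longrightarrow> h i $ a = (\<Sum>j<l. (f i j *\<^sub>v g j) $ a)"
  shows "block_mat k l r c f *\<^sub>v stack_vec l c g = stack_vec k r h"
proof (rule eq_stack_vecI)
  show "block_mat k l r c f *\<^sub>v stack_vec l c g \<in> carrier_vec (k * r)"
    by (rule mult_mat_vec_carrier[of _ _ "l * c"]) simp_all
next
  fix i a assume i: "i < k" and a: "a < r"
  have lt: "i * r + a < k * r" by (rule block_index_less[OF a i])
  have "(block_mat k l r c f *\<^sub>v stack_vec l c g) $ (i * r + a) =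
      (\<Sum>t<l * c. block_mat k l r c f $$ (i * r + a, t) * stack_vec l c g $ t)"
    using lt by (simp add: scalar_prod_def atLeast0LessThan)
  also have "\<dots> = (\<Sum>j<l. \<Sum>b<c. block_mat k l r c f $$ (i * r + a, j * c + b)
                                * stack_vec l c g $ (j * c + b))"
    by (rule sum_lessThan_blocks)
  also have "\<dots> = (\<Sum>j<l. (f i j *\<^sub>v g j) $ a)"
  proof (rule sum.cong[OF refl])
    fix j assume "j \<in> {..<l}"
    then have j: "j < l" by simp
    show "(\<Sum>b<c. block_mat k l r c f $$ (i * r + a, j * c + b) * stack_vec l c g $ (j * c + b))
        = (f i j *\<^sub>v g j) $ a"
      using f[OF i j] g[OF j] a j lt
      by (simp add: scalar_prod_def atLeast0LessThan stack_vec_index block_mat_def block_index_less)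
  qed
  finally show "(block_mat k l r c f *\<^sub>v stack_vec l c g) $ (i * r + a) = h i $ a"
    using h[OF i a] by simp
qed

lemma block_col_mult_vec:
  assumes "\<And>i. i < k \<Longrightarrow> f i \<in> carrier_mat r c" "v \<in> carrier_vec c"
  shows "block_mat k 1 r c (\<lambda>i _. f i) *\<^sub>v v = stack_vec k r (\<lambda>i. f i *\<^sub>v v)"
proof -
  have "stack_vec 1 c (\<lambda>_. v) = v"
    by (rule eq_stack_vecI[symmetric]) (use assms(2) in auto)
  moreover have "block_mat k 1 r c (\<lambda>i _. f i) *\<^sub>v stack_vec 1 c (\<lambda>_. v)
      = stack_vec k r (\<lambda>i. f i *\<^sub>v v)"
    by (rule block_mat_mult_stack_vec) (use assms in auto)
  ultimately show ?thesis by simp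
qed

lemma zero_mat_mult_vec: "v \<in> carrier_vec c \<Longrightarrow> 0\<^sub>m r c *\<^sub>v v = (0\<^sub>v r :: real vec)"
  by (rule eq_vecI) auto

lemma pow_mat_Suc_left:
  fixes A :: "real mat"
  assumes A: "A \<in> carrier_mat n n"
  shows "A ^\<^sub>m Suc k = A * A ^\<^sub>m k"
proof (induction k)
  case 0
  then show ?case using A by simp
next
  case (Suc k)
  have "A ^\<^sub>m Suc (Suc k) = A * A ^\<^sub>m k * A" using Suc.IH by simp
  also have "\<dots> = A * (A ^\<^sub>m k * A)"
    by (rule assoc_mult_mat[OF A pow_carrier_mat[OF A] A])
  finally show ?case by simp
qed

lemma append_cols_mult_vec:
  assumes "M \<in> carrier_mat r c" "N \<in> carrier_mat r d" "a \<in> carrier_vec c" "b \<in> carrier_vec d"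
  shows "append_cols M N *\<^sub>v (a @\<^sub>v b) = M *\<^sub>v a + N *\<^sub>v b"
proof -
  have "append_cols M N *\<^sub>v (a @\<^sub>v b)
      = (M *\<^sub>v a + N *\<^sub>v b) @\<^sub>v (0\<^sub>m 0 c *\<^sub>v a + 0\<^sub>m 0 d *\<^sub>v b)"
    unfolding append_cols_def using assms
    by (subst four_block_mat_mult_vec[of _ r c _ d _ 0]) auto
  also have "\<dots> = M *\<^sub>v a + N *\<^sub>v b"
    by (rule eq_vecI) (use assms in auto)
  finally show ?thesis .
qed

lemma append_cols_carrier:
  assumes "M \<in> carrier_mat r c" "N \<in> carrier_mat r d"
  shows "append_cols M N \<in> carrier_mat r (c + d)"
  using four_block_carrier_mat[OF assms(1), of "0\<^sub>m 0 (dim_col N)" 0 d] assms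
  unfolding append_cols_def by simp

section \<open>The shift registers\<close>

text \<open>The shift drops the oldest block and leaves a zero in the last position, exactly where the
  second summand puts the new block.\<close>

lemma shift_window:
  assumes f: "\<And>i. f i \<in> carrier_vec d"
  shows "shift_mat d l *\<^sub>v stack_vec l d f + last_mat d l *\<^sub>v f l = stack_vec l d (\<lambda>i. f (Suc i))"
proof -
  let ?s = "\<lambda>i. if i + 1 < l then f (Suc i) else 0\<^sub>v d"
  let ?e = "\<lambda>i. if i + 1 = l then f l else 0\<^sub>v d"
  have "shift_mat d l *\<^sub>v stack_vec l d f = stack_vec l d ?s"
    unfolding shift_mat_def
  proof (rule block_mat_mult_stack_vec)
    fix i a assume "i < l" "a < d"
    have "(\<Sum>j<l. ((if j = i + 1 then 1\<^sub>m d else 0\<^sub>m d d) *\<^sub>v f j) $ a)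
        = (\<Sum>j<l. if j = i + 1 then f j $ a else 0)"
      using f \<open>a < d\<close> by (intro sum.cong refl) (auto simp: one_mult_mat_vec[OF f] zero_mat_mult_vec[OF f])
    also have "\<dots> = ?s i $ a"
      using \<open>a < d\<close> by (simp add: sum.delta)
    finally show "?s i $ a = (\<Sum>j<l. ((if j = i + 1 then 1\<^sub>m d else 0\<^sub>m d d) *\<^sub>v f j) $ a)" ..
  qed (use f in auto)
  moreover have "last_mat d l *\<^sub>v f l = stack_vec l d ?e"
    unfolding last_mat_def
    by (subst block_col_mult_vec)
       (use f in \<open>auto intro!: stack_vec_cong simp: one_mult_mat_vec[OF f] zero_mat_mult_vec[OF f]\<close>)
  moreover have "stack_vec l d ?s + stack_vec l d ?e = stack_vec l d (\<lambda>i. ?s i + ?e i)"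
    by (rule stack_vec_add) (use f in auto)
  moreover have "stack_vec l d (\<lambda>i. ?s i + ?e i) = stack_vec l d (\<lambda>i. f (Suc i))"
    by (rule stack_vec_cong) (use f in \<open>auto simp: left_zero_vec[OF f] right_zero_vec[OF f]\<close>)
  ultimately show ?thesis by simp
qed

lemma shift_mat_carrier [simp]: "shift_mat d l \<in> carrier_mat (l * d) (l * d)"
  by (simp add: shift_mat_def)

lemma last_mat_carrier [simp]: "last_mat d l \<in> carrier_mat (l * d) d"
  unfolding last_mat_def using block_mat_carrier[of l 1 d d] by simp

lemma F_mat_carrier [simp]: "F_mat p m l \<in> carrier_mat (l * p + l * m) (l * p + l * m)"
  unfolding F_mat_def by (rule four_block_carrier_mat) simp_all

lemma L_mat_carrier [simp]: "L_mat p m l \<in> carrier_mat (l * p + l * m) p"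
  unfolding L_mat_def by (rule carrier_append_rows) simp_all

lemma B_mat_carrier [simp]: "B_mat p m l \<in> carrier_mat (l * p + l * m) m"
  unfolding B_mat_def by (rule carrier_append_rows) simp_all

text \<open>One register holds a window of \<open>f\<close>, the other a window of \<open>g\<close>; feeding in the entries just
  after the windows moves both windows one step ahead.\<close>

lemma shift_register_step:
  assumes f: "\<And>i. f i \<in> carrier_vec p" and g: "\<And>i. g i \<in> carrier_vec m"
  shows "F_mat p m l *\<^sub>v (stack_vec l p f @\<^sub>v stack_vec l m g)
      + L_mat p m l *\<^sub>v f l + B_mat p m l *\<^sub>v g l
    = stack_vec l p (\<lambda>i. f (Suc i)) @\<^sub>v stack_vec l m (\<lambda>i. g (Suc i))"
proof -
  define sf sg ef eg where "sf = shift_mat p l *\<^sub>v stack_vec l p f"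
    and "sg = shift_mat m l *\<^sub>v stack_vec l m g"
    and "ef = last_mat p l *\<^sub>v f l" and "eg = last_mat m l *\<^sub>v g l"
  have c: "sf \<in> carrier_vec (l * p)" "sg \<in> carrier_vec (l * m)"
    "ef \<in> carrier_vec (l * p)" "eg \<in> carrier_vec (l * m)"
    unfolding sf_def sg_def ef_def eg_def
    by (auto intro!: mult_mat_vec_carrier[OF shift_mat_carrier] mult_mat_vec_carrier[OF last_mat_carrier] f g)
  have "F_mat p m l *\<^sub>v (stack_vec l p f @\<^sub>v stack_vec l m g) = sf @\<^sub>v sg"
    unfolding F_mat_def sf_def sg_def
    by (rule mult_mat_vec_split) simp_all
  moreover have "L_mat p m l *\<^sub>v f l = ef @\<^sub>v 0\<^sub>v (l * m)"
    unfolding L_mat_def ef_def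
    by (subst mat_mult_append[OF last_mat_carrier zero_carrier_mat f])
       (simp add: zero_mat_mult_vec[OF f])
  moreover have "B_mat p m l *\<^sub>v g l = 0\<^sub>v (l * p) @\<^sub>v eg"
    unfolding B_mat_def eg_def
    by (subst mat_mult_append[OF zero_carrier_mat last_mat_carrier g])
       (simp add: zero_mat_mult_vec[OF g])
  moreover have "(sf @\<^sub>v sg) + (ef @\<^sub>v 0\<^sub>v (l * m)) + (0\<^sub>v (l * p) @\<^sub>v eg)
      = (sf + ef) @\<^sub>v (sg + eg)"
    using c by (simp add: append_vec_add[of _ "l * p" _ _ "l * m"])
  moreover have "sf + ef = stack_vec l p (\<lambda>i. f (Suc i))" "sg + eg = stack_vec l m (\<lambda>i. g (Suc i))"
    unfolding sf_def ef_def sg_def eg_def by (rule shift_window, rule f, rule shift_window, rule g)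
  ultimately show ?thesis by simp
qed

section \<open>Zero-state responses and the Toeplitz matrices\<close>

text \<open>State at time \<open>i\<close> of \<open>z\<^sup>+ = A z + M v\<close> started from zero. By linearity the effects of \<open>u\<close> and
  \<open>w\<close> on the plant are two such responses. The recursion replaces the convolution sum
  \<open>\<Sum>j<i. A\<^bsup>i-j-1\<^esup> M v\<^sub>j\<close>.\<close>

fun forced_state :: "real mat \<Rightarrow> real mat \<Rightarrow> (nat \<Rightarrow> real vec) \<Rightarrow> nat \<Rightarrow> real vec" where
  "forced_state A M v 0 = 0\<^sub>v (dim_row A)"
| "forced_state A M v (Suc i) = A *\<^sub>v forced_state A M v i + M *\<^sub>v v i"

lemma forced_state_carrier:
  assumes "A \<in> carrier_mat n n" "M \<in> carrier_mat n c"
  shows "forced_state A M v i \<in> carrier_vec n"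
  by (induction i) (use assms in \<open>auto intro!: carrier_vecI\<close>)

text \<open>The link between the recursion and the convolution sum. The left factor \<open>N\<close> is part of the
  statement because the induction replaces it by \<open>N A\<close>; the instances used are \<open>N = 1\<close> and
  \<open>N = C\<close>.\<close>

lemma mult_forced_state_index:
  assumes A: "A \<in> carrier_mat n n" and M: "M \<in> carrier_mat n c" and v: "\<And>j. v j \<in> carrier_vec c"
    and N: "N \<in> carrier_mat q n" and a: "a < q"
  shows "(N *\<^sub>v forced_state A M v i) $ a = (\<Sum>j<i. (N * A ^\<^sub>m (i - j - 1) * M *\<^sub>v v j) $ a)"
  using N
proof (induction i arbitrary: N)
  case 0
  then show ?case using A a by simp
next
  case (Suc i)
  note fs = forced_state_carrier[OF A M, of v i]
  have NA: "N * A \<in> carrier_mat q n" using Suc.prems A by simp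
  have pow: "N * A * A ^\<^sub>m (i - j - 1) = N * A ^\<^sub>m (Suc i - j - 1)" if "j < i" for j
  proof -
    have "N * A * A ^\<^sub>m (i - j - 1) = N * (A * A ^\<^sub>m (i - j - 1))"
      using Suc.prems A by (intro assoc_mult_mat[of _ q n _ n _ n]) auto
    also have "A * A ^\<^sub>m (i - j - 1) = A ^\<^sub>m (Suc (i - j - 1))"
      by (rule pow_mat_Suc_left[OF A, symmetric])
    also have "Suc (i - j - 1) = Suc i - j - 1" using that by simp
    finally show ?thesis .
  qed
  have "N *\<^sub>v forced_state A M v (Suc i) = (N * A) *\<^sub>v forced_state A M v i + (N * M) *\<^sub>v v i"
    using Suc.prems A M v[of i] fs
    by (simp add: mult_add_distrib_mat_vec[of N q n] assoc_mult_mat_vec[of N q n])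
  then have "(N *\<^sub>v forced_state A M v (Suc i)) $ a
      = ((N * A) *\<^sub>v forced_state A M v i) $ a + ((N * M) *\<^sub>v v i) $ a"
    using a Suc.prems by simp
  also have "((N * A) *\<^sub>v forced_state A M v i) $ a
      = (\<Sum>j<i. (N * A ^\<^sub>m (Suc i - j - 1) * M *\<^sub>v v j) $ a)"
    unfolding Suc.IH[OF NA] by (intro sum.cong refl) (simp only: pow lessThan_iff)
  finally show ?case using Suc.prems A by (simp add: right_mult_one_mat[of N q n])
qed

lemma R_mat_mult_stack_vec:
  assumes A: "A \<in> carrier_mat n n" and M: "M \<in> carrier_mat n c" and v: "\<And>j. v j \<in> carrier_vec c"
  shows "R_mat A M l *\<^sub>v stack_vec l c v = forced_state A M v l"
proof -
  have "R_mat A M l *\<^sub>v stack_vec l c v = stack_vec 1 n (\<lambda>_. forced_state A M v l)"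
    unfolding R_mat_def carrier_matD(1)[OF A] carrier_matD(2)[OF M]
  proof (rule block_mat_mult_stack_vec)
    fix a assume "a < n"
    have "(1\<^sub>m n *\<^sub>v forced_state A M v l) $ a = (\<Sum>j<l. (1\<^sub>m n * A ^\<^sub>m (l - j - 1) * M *\<^sub>v v j) $ a)"
      by (rule mult_forced_state_index[OF A M v one_carrier_mat \<open>a < n\<close>])
    then show "forced_state A M v l $ a = (\<Sum>j<l. (A ^\<^sub>m (l - 1 - j) * M *\<^sub>v v j) $ a)"
      using forced_state_carrier[OF A M, of v l]
      by (simp add: left_mult_one_mat[OF pow_carrier_mat[OF A]])
  qed (use A M v in auto)
  also have "\<dots> = forced_state A M v l"
    by (rule eq_stack_vecI[symmetric]) (use forced_state_carrier[OF A M, of v l] in auto)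
  finally show ?thesis .
qed

lemma sum_strictly_below:
  fixes g :: "nat \<Rightarrow> real"
  assumes "i < l"
  shows "(\<Sum>j<l. if j < i then g j else 0) = (\<Sum>j<i. g j)"
proof -
  have "(\<Sum>j<i. g j) = (\<Sum>j<i. if j < i then g j else 0)" by simp
  also have "\<dots> = (\<Sum>j<l. if j < i then g j else 0)"
    by (rule sum.mono_neutral_left) (use assms in auto)
  finally show ?thesis ..
qed

text \<open>Block row \<open>i\<close> of the lower triangular Toeplitz matrix computes the output at time \<open>i\<close> caused by
  the inputs \<open>v\<^sub>0, \<dots>, v\<^sub>i\<close>, with feedthrough \<open>Q\<close> on the diagonal.\<close>

lemma Tw_mat_mult_stack_vec:
  assumes A: "A \<in> carrier_mat n n" and M: "M \<in> carrier_mat n c" and C: "C \<in> carrier_mat p n"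
    and Q: "Q \<in> carrier_mat p c" and v: "\<And>j. v j \<in> carrier_vec c"
  shows "Tw_mat A M C Q l *\<^sub>v stack_vec l c v
    = stack_vec l p (\<lambda>i. C *\<^sub>v forced_state A M v i + Q *\<^sub>v v i)"
proof -
  let ?f = "\<lambda>i j. if j < i then C * A ^\<^sub>m (i - j - 1) * M else if i = j then Q else 0\<^sub>m p c"
  have f: "?f i j \<in> carrier_mat p c" for i j using A M C Q by auto
  have "block_mat l l p c ?f *\<^sub>v stack_vec l c v
    = stack_vec l p (\<lambda>i. C *\<^sub>v forced_state A M v i + Q *\<^sub>v v i)"
  proof (rule block_mat_mult_stack_vec[OF f v])
    fix i a assume i: "i < l" and a: "a < p"
    have "(\<Sum>j<l. (?f i j *\<^sub>v v j) $ a)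
      = (\<Sum>j<l. (if j < i then (C * A ^\<^sub>m (i - j - 1) * M *\<^sub>v v j) $ a else 0)
               + (if j = i then (Q *\<^sub>v v j) $ a else 0))"
      using a by (intro sum.cong refl) (auto simp: zero_mat_mult_vec[OF v])
    also have "\<dots> = (C *\<^sub>v forced_state A M v i) $ a + (Q *\<^sub>v v i) $ a"
      using i a by (simp add: sum.distrib sum.delta sum_strictly_below
          mult_forced_state_index[OF A M v C])
    finally show "(C *\<^sub>v forced_state A M v i + Q *\<^sub>v v i) $ a = (\<Sum>j<l. (?f i j *\<^sub>v v j) $ a)"
      using Q a by simp
  qed
  then show ?thesis
    unfolding Tw_mat_def carrier_matD(1)[OF C] carrier_matD(2)[OF M] .
qed

lemma Tu_mat_eq_Tw_mat: "Tu_mat A B C l = Tw_mat A B C (0\<^sub>m (dim_row C) (dim_col B)) l"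
proof -
  have "(\<lambda>i j. if j < i then C * A ^\<^sub>m (i - j - 1) * B else 0\<^sub>m (dim_row C) (dim_col B))
    = (\<lambda>i j. if j < i then C * A ^\<^sub>m (i - j - 1) * B
            else if i = j then 0\<^sub>m (dim_row C) (dim_col B) else 0\<^sub>m (dim_row C) (dim_col B))"
    by (intro ext) simp
  then show ?thesis unfolding Tu_mat_def Tw_mat_def by (rule arg_cong)
qed

lemma Tu_mat_mult_stack_vec:
  assumes A: "A \<in> carrier_mat n n" and B: "B \<in> carrier_mat n m" and C: "C \<in> carrier_mat p n"
    and u: "\<And>j. u j \<in> carrier_vec m"
  shows "Tu_mat A B C l *\<^sub>v stack_vec l m u = stack_vec l p (\<lambda>i. C *\<^sub>v forced_state A B u i)"
proof -
  have "Tu_mat A B C l = Tw_mat A B C (0\<^sub>m p m) l"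
    using Tu_mat_eq_Tw_mat[of A B C l] B C by simp
  then have "Tu_mat A B C l *\<^sub>v stack_vec l m u
      = stack_vec l p (\<lambda>i. C *\<^sub>v forced_state A B u i + 0\<^sub>m p m *\<^sub>v u i)"
    using Tw_mat_mult_stack_vec[OF A B C zero_carrier_mat u, of l] by (simp only:)
  also have "\<dots> = stack_vec l p (\<lambda>i. C *\<^sub>v forced_state A B u i)"
    by (intro stack_vec_cong)
       (simp add: zero_mat_mult_vec[OF u] mult_mat_vec_carrier[OF C forced_state_carrier[OF A B]])
  finally show ?thesis .
qed

lemma obs_mat_mult_vec:
  assumes A: "A \<in> carrier_mat n n" and C: "C \<in> carrier_mat p n" and x: "x \<in> carrier_vec n"
  shows "obs_mat A C l *\<^sub>v x = stack_vec l p (\<lambda>i. C *\<^sub>v (A ^\<^sub>m i *\<^sub>v x))"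
proof -
  have "obs_mat A C l *\<^sub>v x = stack_vec l p (\<lambda>i. (C * A ^\<^sub>m i) *\<^sub>v x)"
    unfolding obs_mat_def carrier_matD(1)[OF C] carrier_matD(1)[OF A]
    by (rule block_col_mult_vec) (use A C x in auto)
  also have "\<dots> = stack_vec l p (\<lambda>i. C *\<^sub>v (A ^\<^sub>m i *\<^sub>v x))"
    by (rule stack_vec_cong) (rule assoc_mult_mat_vec[OF C pow_carrier_mat[OF A] x])
  finally show ?thesis .
qed

text \<open>Superposition of the free response and of the two forced responses.\<close>

lemma state_response:
  assumes A: "A \<in> carrier_mat n n" and B: "B \<in> carrier_mat n m" and P: "P \<in> carrier_mat n nw"
    and u: "\<And>i. u i \<in> carrier_vec m" and w: "\<And>i. w i \<in> carrier_vec nw"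
    and x0: "x 0 \<in> carrier_vec n"
    and x: "\<And>i. x (Suc i) = A *\<^sub>v x i + B *\<^sub>v u i + P *\<^sub>v w i"
  shows "x i = A ^\<^sub>m i *\<^sub>v x 0 + (forced_state A B u i + forced_state A P w i)"
proof (induction i)
  case 0
  then show ?case using A x0 by simp
next
  case (Suc i)
  note c = forced_state_carrier[OF A B, of u i] forced_state_carrier[OF A P, of w i]
  have p: "A ^\<^sub>m i *\<^sub>v x 0 \<in> carrier_vec n"
    by (rule mult_mat_vec_carrier[OF pow_carrier_mat[OF A] x0])
  have "A ^\<^sub>m Suc i *\<^sub>v x 0 = A *\<^sub>v (A ^\<^sub>m i *\<^sub>v x 0)"
    using assoc_mult_mat_vec[OF A pow_carrier_mat[OF A] x0, of i]
    by (simp only: pow_mat_Suc_left[OF A])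
  moreover have "A *\<^sub>v x i = A *\<^sub>v (A ^\<^sub>m i *\<^sub>v x 0)
      + (A *\<^sub>v forced_state A B u i + A *\<^sub>v forced_state A P w i)"
    unfolding Suc.IH using c p by (simp add: mult_add_distrib_mat_vec[OF A])
  ultimately show ?case
    unfolding x by (intro eq_vecI) (use A B P in auto)
qed

section \<open>The output as a function of the past data\<close>

lemma Tu_mat_carrier:
  assumes "B \<in> carrier_mat n m" "C \<in> carrier_mat p n"
  shows "Tu_mat A B C l \<in> carrier_mat (l * p) (l * m)"
  unfolding Tu_mat_def carrier_matD(1)[OF assms(2)] carrier_matD(2)[OF assms(1)]
  by (rule block_mat_carrier)

lemma Tw_mat_carrier:
  assumes "P \<in> carrier_mat n nw" "C \<in> carrier_mat p n"
  shows "Tw_mat A P C Q l \<in> carrier_mat (l * p) (l * nw)"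
  unfolding Tw_mat_def carrier_matD(1)[OF assms(2)] carrier_matD(2)[OF assms(1)]
  by (rule block_mat_carrier)

lemma R_mat_carrier:
  assumes "A \<in> carrier_mat n n" "M \<in> carrier_mat n c"
  shows "R_mat A M l \<in> carrier_mat n (l * c)"
  unfolding R_mat_def carrier_matD(1)[OF assms(1)] carrier_matD(2)[OF assms(2)]
  using block_mat_carrier[of 1 l n c] by simp

lemma output_gain_carrier:
  assumes "A \<in> carrier_mat n n" "C \<in> carrier_mat p n" "OL \<in> carrier_mat n (l * p)"
  shows "C * A ^\<^sub>m l * OL \<in> carrier_mat p (l * p)"
  by (rule mult_carrier_mat[OF mult_carrier_mat[OF assms(2) pow_carrier_mat[OF assms(1)]] assms(3)])

lemma Z1_mat_carrier:
  assumes "A \<in> carrier_mat n n" "B \<in> carrier_mat n m" "C \<in> carrier_mat p n"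
    and "OL \<in> carrier_mat n (l * p)"
  shows "Z1_mat A B C l OL \<in> carrier_mat p (l * p + l * m)"
  unfolding Z1_mat_def
  by (rule append_cols_carrier[OF _ minus_carrier_mat[OF mult_carrier_mat[OF _ Tu_mat_carrier]]])
     (rule output_gain_carrier[OF assms(1,3,4)] assms(2,3))+

lemma Z2_mat_carrier:
  assumes "A \<in> carrier_mat n n" "P \<in> carrier_mat n nw" "C \<in> carrier_mat p n"
    and "OL \<in> carrier_mat n (l * p)" "Q \<in> carrier_mat p nw"
  shows "Z2_mat A P C Q l OL \<in> carrier_mat p (l * nw + nw)"
  unfolding Z2_mat_def
  by (rule append_cols_carrier[OF minus_carrier_mat[OF mult_carrier_mat[OF _ Tw_mat_carrier]]])
     (rule output_gain_carrier[OF assms(1,3,4)] assms(2,3,5))+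

text \<open>The left inverse turns the stacked output equation into a formula for the state at the start of
  the window. Below, \<open>G = C A\<^sup>l O\<^sup>L\<close> maps the stacked free response to the free output at time \<open>l\<close>;
  applying \<open>G\<close> to \<open>Y\<close> also brings in the forced terms \<open>G TU\<close> and \<open>G TW\<close>, which the
  corrections \<open>- G T\<^sub>u\<close> and \<open>- G T\<^sub>w\<close> inside \<open>Z\<^sub>1\<close> and \<open>Z\<^sub>2\<close> cancel.\<close>

lemma output_from_window:
  assumes A: "A \<in> carrier_mat n n" and B: "B \<in> carrier_mat n m" and P: "P \<in> carrier_mat n nw"
    and C: "C \<in> carrier_mat p n" and Q: "Q \<in> carrier_mat p nw"
    and OL: "OL \<in> carrier_mat n (l * p)" "OL * obs_mat A C l = 1\<^sub>m n"
    and u: "\<And>i. u i \<in> carrier_vec m" and w: "\<And>i. w i \<in> carrier_vec nw"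
    and x0: "x 0 \<in> carrier_vec n"
    and x: "\<And>i. x (Suc i) = A *\<^sub>v x i + B *\<^sub>v u i + P *\<^sub>v w i"
    and y: "\<And>i. y i = C *\<^sub>v x i + Q *\<^sub>v w i"
  shows "Z1_mat A B C l OL *\<^sub>v (stack_vec l p y @\<^sub>v stack_vec l m u)
       + Z2_mat A P C Q l OL *\<^sub>v (stack_vec l nw w @\<^sub>v w l) = y l"
proof -
  define G where "G = C * A ^\<^sub>m l * OL"
  define Y U W where "Y = stack_vec l p y" and "U = stack_vec l m u" and "W = stack_vec l nw w"
  define O0 where "O0 = obs_mat A C l *\<^sub>v x 0"
  define TU where "TU = Tu_mat A B C l *\<^sub>v U"
  define TW where "TW = Tw_mat A P C Q l *\<^sub>v W"
  define fu fw where "fu = forced_state A B u" and "fw = forced_state A P w"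
  note Tu_c = Tu_mat_carrier[OF B C, of A l] and Tw_c = Tw_mat_carrier[OF P C, of A Q l]
    and Ru_c = R_mat_carrier[OF A B, of l] and Rw_c = R_mat_carrier[OF A P, of l]
  have G: "G \<in> carrier_mat p (l * p)"
    unfolding G_def by (rule output_gain_carrier[OF A C OL(1)])
  have O: "obs_mat A C l \<in> carrier_mat (l * p) n"
    unfolding obs_mat_def carrier_matD(1)[OF C] carrier_matD(1)[OF A]
    using block_mat_carrier[of l 1 p n] by simp
  have U: "U \<in> carrier_vec (l * m)" and W: "W \<in> carrier_vec (l * nw)" and Yc: "Y \<in> carrier_vec (l * p)"
    unfolding U_def W_def Y_def by simp_all
  have fu: "fu i \<in> carrier_vec n" and fw: "fw i \<in> carrier_vec n" for i
    unfolding fu_def fw_def by (rule forced_state_carrier[OF A B], rule forced_state_carrier[OF A P])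
  have Ax: "A ^\<^sub>m i *\<^sub>v x 0 \<in> carrier_vec n" for i
    by (rule mult_mat_vec_carrier[OF pow_carrier_mat[OF A] x0])
  have O0: "O0 \<in> carrier_vec (l * p)" and TU: "TU \<in> carrier_vec (l * p)" and TW: "TW \<in> carrier_vec (l * p)"
    unfolding O0_def TU_def TW_def
    by (rule mult_mat_vec_carrier[OF O x0], rule mult_mat_vec_carrier[OF Tu_c U],
        rule mult_mat_vec_carrier[OF Tw_c W])
  have resp: "x i = A ^\<^sub>m i *\<^sub>v x 0 + (fu i + fw i)" for i
    unfolding fu_def fw_def by (rule state_response[where x = x, OF A B P u w x0 x])
  have Cx: "C *\<^sub>v x i = C *\<^sub>v (A ^\<^sub>m i *\<^sub>v x 0) + (C *\<^sub>v fu i + C *\<^sub>v fw i)" for i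
    unfolding resp[of i] using Ax[of i] fu[of i] fw[of i] by (simp add: mult_add_distrib_mat_vec[OF C])
  have Y_split: "Y = O0 + (TU + TW)"
  proof -
    note carriers = mult_mat_vec_carrier[OF C Ax] mult_mat_vec_carrier[OF C fu]
      mult_mat_vec_carrier[OF C fw] mult_mat_vec_carrier[OF Q w]
    have forced: "TU + TW = stack_vec l p (\<lambda>i. C *\<^sub>v fu i + (C *\<^sub>v fw i + Q *\<^sub>v w i))"
      unfolding TU_def TW_def U_def W_def Tu_mat_mult_stack_vec[where u = u, OF A B C u]
        Tw_mat_mult_stack_vec[where v = w, OF A P C Q w] fu_def[symmetric] fw_def[symmetric]
      by (rule stack_vec_add) (intro add_carrier_vec carriers)+
    have "O0 + (TU + TW) = stack_vec l p (\<lambda>i. C *\<^sub>v (A ^\<^sub>m i *\<^sub>v x 0)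
        + (C *\<^sub>v fu i + (C *\<^sub>v fw i + Q *\<^sub>v w i)))"
      unfolding O0_def obs_mat_mult_vec[OF A C x0] forced
      by (rule stack_vec_add) (intro add_carrier_vec carriers)+
    also have "\<dots> = Y"
      unfolding Y_def
      by (rule stack_vec_cong, unfold y Cx) (intro eq_vecI, use C Q in auto)
    finally show ?thesis ..
  qed
  have GO0: "G *\<^sub>v O0 = C *\<^sub>v (A ^\<^sub>m l *\<^sub>v x 0)"
  proof -
    have CA: "C * A ^\<^sub>m l \<in> carrier_mat p n" by (rule mult_carrier_mat[OF C pow_carrier_mat[OF A]])
    have "G *\<^sub>v O0 = (C * A ^\<^sub>m l) *\<^sub>v (OL *\<^sub>v O0)"
      unfolding G_def by (rule assoc_mult_mat_vec[OF CA OL(1) O0])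
    also have "OL *\<^sub>v O0 = x 0"
      unfolding O0_def assoc_mult_mat_vec[OF OL(1) O x0, symmetric] OL(2) using x0 by simp
    also have "(C * A ^\<^sub>m l) *\<^sub>v x 0 = C *\<^sub>v (A ^\<^sub>m l *\<^sub>v x 0)"
      by (rule assoc_mult_mat_vec[OF C pow_carrier_mat[OF A] x0])
    finally show ?thesis .
  qed
  have GY: "G *\<^sub>v Y = C *\<^sub>v (A ^\<^sub>m l *\<^sub>v x 0) + (G *\<^sub>v TU + G *\<^sub>v TW)"
    unfolding Y_split using O0 TU TW by (simp add: mult_add_distrib_mat_vec[OF G] GO0)
  have 1: "(C * R_mat A B l - G * Tu_mat A B C l) *\<^sub>v U = C *\<^sub>v fu l - G *\<^sub>v TU"
    unfolding TU_def fu_def R_mat_mult_stack_vec[where v = u, OF A B u, symmetric] U_def[symmetric]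
      assoc_mult_mat_vec[OF C Ru_c U, symmetric] assoc_mult_mat_vec[OF G Tu_c U, symmetric]
    by (rule minus_mult_distrib_mat_vec[OF mult_carrier_mat[OF C Ru_c] mult_carrier_mat[OF G Tu_c] U])
  have 2: "(C * R_mat A P l - G * Tw_mat A P C Q l) *\<^sub>v W = C *\<^sub>v fw l - G *\<^sub>v TW"
    unfolding TW_def fw_def R_mat_mult_stack_vec[where v = w, OF A P w, symmetric] W_def[symmetric]
      assoc_mult_mat_vec[OF C Rw_c W, symmetric] assoc_mult_mat_vec[OF G Tw_c W, symmetric]
    by (rule minus_mult_distrib_mat_vec[OF mult_carrier_mat[OF C Rw_c] mult_carrier_mat[OF G Tw_c] W])
  have "Z1_mat A B C l OL *\<^sub>v (Y @\<^sub>v U) = G *\<^sub>v Y + (C *\<^sub>v fu l - G *\<^sub>v TU)"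
    unfolding Z1_mat_def G_def[symmetric] 1[symmetric]
    by (rule append_cols_mult_vec[OF G minus_carrier_mat[OF mult_carrier_mat[OF G Tu_c]] Yc U])
  moreover have "Z2_mat A P C Q l OL *\<^sub>v (W @\<^sub>v w l) = (C *\<^sub>v fw l - G *\<^sub>v TW) + Q *\<^sub>v w l"
    unfolding Z2_mat_def G_def[symmetric] 2[symmetric]
    by (rule append_cols_mult_vec[OF minus_carrier_mat[OF mult_carrier_mat[OF G Tw_c]] Q W w])
  moreover have "G *\<^sub>v Y + (C *\<^sub>v fu l - G *\<^sub>v TU) + ((C *\<^sub>v fw l - G *\<^sub>v TW) + Q *\<^sub>v w l) = y l"
    unfolding GY y Cx by (rule eq_vecI) (use C Q G in auto)
  ultimately show ?thesis unfolding Y_def U_def W_def by simp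
qed

section \<open>Running the exosystem backwards\<close>

text \<open>A kernel vector of \<open>S\<close> over the complex numbers would be an eigenvector for \<open>0\<close>, and the
  determinant does not see the change of field.\<close>

lemma mat_inverse_of_eigenvalues_nonzero:
  fixes S :: "real mat"
  assumes S: "S \<in> carrier_mat n n"
    and ev: "\<not> eigenvalue (map_mat complex_of_real S) 0"
  obtains Si where "mat_inverse S = Some Si" "Si \<in> carrier_mat n n" "Si * S = 1\<^sub>m n"
proof -
  let ?S = "map_mat complex_of_real S"
  have Sc: "?S \<in> carrier_mat n n" using S by simp
  have "det ?S \<noteq> 0"
  proof
    assume "det ?S = 0"
    then obtain v where v: "v \<in> carrier_vec n" "v \<noteq> 0\<^sub>v n" "?S *\<^sub>v v = 0\<^sub>v n"
      using det_0_iff_vec_prod_zero[OF Sc] by auto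
    moreover have "0 \<cdot>\<^sub>v v = 0\<^sub>v n" using v(1) by auto
    ultimately have "eigenvector ?S v 0"
      unfolding eigenvector_def using S by simp
    then show False using ev unfolding eigenvalue_def by blast
  qed
  then have "det S \<noteq> 0" by (simp add: of_real_hom.hom_det)
  then have "S \<in> Units (ring_mat TYPE(real) n ())" by (rule det_non_zero_imp_unit[OF S])
  then obtain Si where "mat_inverse S = Some Si"
    using mat_inverse(1)[OF S, where b = "()"] by (cases "mat_inverse S") auto
  with mat_inverse(2)[OF S this] that show ?thesis by blast
qed

lemma inverse_pow_rewinds:
  fixes S Si :: "real mat"
  assumes S: "S \<in> carrier_mat n n" and Si: "Si \<in> carrier_mat n n" "Si * S = 1\<^sub>m n"
    and w: "\<And>i. w i \<in> carrier_vec n" and step: "\<And>i. w (Suc i) = S *\<^sub>v w i"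
  shows "Si ^\<^sub>m j *\<^sub>v w (i + j) = w i"
proof (induction j)
  case 0
  then show ?case using Si w by simp
next
  case (Suc j)
  have "Si ^\<^sub>m Suc j *\<^sub>v w (i + Suc j) = Si ^\<^sub>m j *\<^sub>v (Si *\<^sub>v (S *\<^sub>v w (i + j)))"
    using assoc_mult_mat_vec[OF pow_carrier_mat[OF Si(1)] Si(1) mult_mat_vec_carrier[OF S w]]
    by (simp add: step)
  also have "Si *\<^sub>v (S *\<^sub>v w (i + j)) = w (i + j)"
    unfolding assoc_mult_mat_vec[OF Si(1) S w, symmetric] Si(2) using w by simp
  finally show ?case using Suc.IH by simp
qed

lemma S_stack_carrier: "S \<in> carrier_mat n n \<Longrightarrow> S_stack S l \<in> carrier_mat (l * n + n) n"
  unfolding S_stack_def using block_mat_carrier[of "l + 1" 1 n n] by (simp add: add.commute)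

text \<open>Since \<open>w l = S\<^bsup>l-i\<^esup> (w i)\<close>, the block row \<open>S\<^bsup>-(l-i)\<^esup>\<close> sends \<open>w l\<close> back to \<open>w i\<close>.\<close>

lemma S_stack_mult_vec:
  assumes S: "S \<in> carrier_mat n n"
    and ev: "\<not> eigenvalue (map_mat complex_of_real S) 0"
    and w: "\<And>i. w i \<in> carrier_vec n" and step: "\<And>i. w (Suc i) = S *\<^sub>v w i"
  shows "S_stack S l *\<^sub>v w l = stack_vec l n w @\<^sub>v w l"
proof -
  obtain Si where Si: "mat_inverse S = Some Si" "Si \<in> carrier_mat n n" "Si * S = 1\<^sub>m n"
    by (rule mat_inverse_of_eigenvalues_nonzero[OF S ev])
  have "S_stack S l *\<^sub>v w l = stack_vec (l + 1) n (\<lambda>i. Si ^\<^sub>m (l - i) *\<^sub>v w l)"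
    unfolding S_stack_def Si(1) option.sel carrier_matD(1)[OF S]
    by (rule block_col_mult_vec[OF pow_carrier_mat[OF Si(2)] w])
  also have "\<dots> = stack_vec (l + 1) n w"
  proof (rule stack_vec_cong)
    fix i assume "i < l + 1"
    then show "Si ^\<^sub>m (l - i) *\<^sub>v w l = w i"
      using inverse_pow_rewinds[where w = w, OF S Si(2,3) w step, of "l - i" i] by simp
  qed
  also have "\<dots> = stack_vec l n w @\<^sub>v w l" by (rule stack_vec_Suc[OF w])
  finally show ?thesis .
qed

section \<open>Evolution of the window of past data\<close>

lemma past_data_carrier [simp]: "past_data p m l y u k \<in> carrier_vec (l * p + l * m)"
  unfolding past_data_def by (rule append_carrier_vec) simp_all

lemma past_data_Suc:
  assumes y: "\<And>i. y i \<in> carrier_vec p" and u: "\<And>i. u i \<in> carrier_vec m" and k: "l \<le> k"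
  shows "F_mat p m l *\<^sub>v past_data p m l y u k + L_mat p m l *\<^sub>v y k + B_mat p m l *\<^sub>v u k
    = past_data p m l y u (Suc k)"
  using shift_register_step[of "\<lambda>i. y (k - l + i)" p "\<lambda>i. u (k - l + i)" m l] y u k
  by (simp add: past_data_def Suc_diff_le)

text \<open>The initial register contents can be read as fictitious signal values at the times
  \<open>-l, \<dots>, -1\<close>. With the signals extended in this way (and indices moved up by \<open>l\<close>), the register
  holds a window of the extended signals at every time, and from time \<open>l\<close> on that window no longer
  meets the fictitious part.\<close>

lemma shift_register_forgets_initial_state:
  assumes chi0: "chi 0 \<in> carrier_vec (l * p + l * m)"
    and y: "\<And>i. y i \<in> carrier_vec p" and u: "\<And>i. u i \<in> carrier_vec m"
    and step: "\<And>k. chi (Suc k) = F_mat p m l *\<^sub>v chi k + L_mat p m l *\<^sub>v y k + B_mat p m l *\<^sub>v u k"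
    and k: "l \<le> k"
  shows "chi k = past_data p m l y u k"
proof -
  define a where "a = vec_first (chi 0) (l * p)"
  define b where "b = vec_last (chi 0) (l * m)"
  define ya where "ya i = (if i < l then vec p (\<lambda>j. a $ (i * p + j)) else y (i - l))" for i
  define ub where "ub i = (if i < l then vec m (\<lambda>j. b $ (i * m + j)) else u (i - l))" for i
  have ya: "ya i \<in> carrier_vec p" and ub: "ub i \<in> carrier_vec m" for i
    unfolding ya_def ub_def using y u by auto
  have "chi k = stack_vec l p (\<lambda>i. ya (k + i)) @\<^sub>v stack_vec l m (\<lambda>i. ub (k + i))" for k
  proof (induction k)
    case 0
    have "stack_vec l p ya = stack_vec l p (\<lambda>i. vec p (\<lambda>j. a $ (i * p + j)))"
      by (rule stack_vec_cong) (simp add: ya_def)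
    also have "\<dots> = a" by (rule stack_vec_of_vec) (simp add: a_def)
    finally have "stack_vec l p ya = a" .
    moreover have "stack_vec l m ub = stack_vec l m (\<lambda>i. vec m (\<lambda>j. b $ (i * m + j)))"
      by (rule stack_vec_cong) (simp add: ub_def)
    then have "stack_vec l m ub = b" using stack_vec_of_vec[of b l m] by (simp add: b_def)
    ultimately show ?case using chi0 by (simp add: a_def b_def)
  next
    case (Suc k)
    have "ya (k + l) = y k" "ub (k + l) = u k" by (simp_all add: ya_def ub_def)
    then show ?case
      using shift_register_step[of "\<lambda>i. ya (k + i)" p "\<lambda>i. ub (k + i)" m l] ya ub
      by (simp add: step Suc.IH)
  qed
  moreover have "ya (k + i) = y (k - l + i)" "ub (k + i) = u (k - l + i)" for i
    using k by (simp_all add: ya_def ub_def)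
  ultimately show ?thesis by (simp add: past_data_def)
qed

text \<open>The plant is time invariant, so the identity for the window starting at time \<open>0\<close> applies to
  the signals shifted by \<open>k - l\<close>.\<close>

lemma output_from_past_data:
  assumes S: "S \<in> carrier_mat nw nw"
    and A: "A \<in> carrier_mat n n" and B: "B \<in> carrier_mat n m" and P: "P \<in> carrier_mat n nw"
    and C: "C \<in> carrier_mat p n" and Q: "Q \<in> carrier_mat p nw"
    and OL: "OL \<in> carrier_mat n (l * p)" "OL * obs_mat A C l = 1\<^sub>m n"
    and ev: "\<not> eigenvalue (map_mat complex_of_real S) 0"
    and u: "\<And>i. u i \<in> carrier_vec m" and w: "\<And>i. w i \<in> carrier_vec nw"
    and x: "\<And>i. x i \<in> carrier_vec n"
    and w_step: "\<And>i. w (Suc i) = S *\<^sub>v w i"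
    and x_step: "\<And>i. x (Suc i) = A *\<^sub>v x i + B *\<^sub>v u i + P *\<^sub>v w i"
    and y: "\<And>i. y i = C *\<^sub>v x i + Q *\<^sub>v w i"
    and k: "l \<le> k"
  shows "Z1_mat A B C l OL *\<^sub>v past_data p m l y u k
       + (Z2_mat A P C Q l OL * S_stack S l) *\<^sub>v w k = y k"
proof -
  define s where "s = k - l"
  have k_eq: "s + l = k" using k by (simp add: s_def)
  have "(Z2_mat A P C Q l OL * S_stack S l) *\<^sub>v w k
      = Z2_mat A P C Q l OL *\<^sub>v (S_stack S l *\<^sub>v w k)"
    by (rule assoc_mult_mat_vec[OF Z2_mat_carrier[OF A P C OL(1) Q] S_stack_carrier[OF S] w])
  also have "S_stack S l *\<^sub>v w k = stack_vec l nw (\<lambda>i. w (s + i)) @\<^sub>v w (s + l)"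
    using S_stack_mult_vec[OF S ev, of "\<lambda>i. w (s + i)" l] w by (simp add: w_step k_eq)
  finally show ?thesis
    using output_from_window[where x = "\<lambda>i. x (s + i)" and y = "\<lambda>i. y (s + i)"
        and u = "\<lambda>i. u (s + i)" and w = "\<lambda>i. w (s + i)", OF A B P C Q OL] u w x x_step y
    by (simp add: past_data_def s_def[symmetric] k_eq)
qed

section \<open>Equivalence of the plant and its past-data model\<close>

theorem lemma4p4:
  fixes nw n m p l :: nat
    and S A B P C Q OL :: "real mat"
  assumes S: "S \<in> carrier_mat nw nw"
    and A: "A \<in> carrier_mat n n"
    and B: "B \<in> carrier_mat n m"
    and P: "P \<in> carrier_mat n nw"
    and C: "C \<in> carrier_mat p n"
    and Q: "Q \<in> carrier_mat p nw"
    and obs: "observable A C"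
    and l: "l = obs_index A C"
    and OL: "OL \<in> carrier_mat n (p * l)" "OL * obs_mat A C l = 1\<^sub>m n"
    and eig: "\<forall>z. eigenvalue (map_mat complex_of_real S) z \<longrightarrow> cmod z \<ge> 1"
  shows
    "\<forall>w0 \<in> carrier_vec nw. \<forall>x0 \<in> carrier_vec n. \<forall>chi0 \<in> carrier_vec ((p + m) * l).
     \<forall>u :: nat \<Rightarrow> real vec. (\<forall>k. u k \<in> carrier_vec m) \<longrightarrow>
     (\<exists>xi0 \<in> carrier_vec ((p + m) * l).
       \<forall>w x chi y omega xi v phi :: nat \<Rightarrow> real vec.
         w 0 = w0 \<and> x 0 = x0 \<and> chi 0 = chi0 \<and>
         (\<forall>k. y k = C *\<^sub>v x k + Q *\<^sub>v w k) \<and>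
         (\<forall>k. w (k + 1) = S *\<^sub>v w k) \<and>
         (\<forall>k. x (k + 1) = A *\<^sub>v x k + B *\<^sub>v u k + P *\<^sub>v w k) \<and>
         (\<forall>k. chi (k + 1) = F_mat p m l *\<^sub>v chi k + L_mat p m l *\<^sub>v y k + B_mat p m l *\<^sub>v u k) \<and>
         omega l = S ^\<^sub>m l *\<^sub>v w0 \<and> xi l = xi0 \<and>
         (\<forall>k\<ge>l. v k = u k) \<and>
         (\<forall>k\<ge>l. omega (k + 1) = S *\<^sub>v omega k) \<and>
         (\<forall>k\<ge>l. xi (k + 1) =
            A_mat A B C l OL *\<^sub>v xi k + B_mat p m l *\<^sub>v v k
            + (L_mat p m l * Z2_mat A P C Q l OL * S_stack S l) *\<^sub>v omega k) \<and>
         (\<forall>k\<ge>l. phi k =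
            Z1_mat A B C l OL *\<^sub>v xi k + (Z2_mat A P C Q l OL * S_stack S l) *\<^sub>v omega k)
         \<longrightarrow>
         (\<forall>k\<ge>l. xi k = past_data p m l y u k \<and> past_data p m l y u k = chi k \<and> phi k = y k))"
proof (intro ballI allI impI)
  fix w0 x0 chi0 :: "real vec" and u :: "nat \<Rightarrow> real vec"
  assume w0: "w0 \<in> carrier_vec nw" and x0: "x0 \<in> carrier_vec n"
    and chi0: "chi0 \<in> carrier_vec ((p + m) * l)" and "\<forall>k. u k \<in> carrier_vec m"
  then have u: "\<And>k. u k \<in> carrier_vec m" by blast
  have OL_c: "OL \<in> carrier_mat n (l * p)" using OL(1) by (simp add: mult.commute)
  have dims: "(p + m) * l = l * p + l * m" by (simp add: algebra_simps)
  have ev: "\<not> eigenvalue (map_mat complex_of_real S) 0" using eig by force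
  \<comment> \<open>The plant data determine its trajectory, so it is constructed here: the initial state of \<open>\<xi>\<close>
      has to be chosen before the signals are given.\<close>
  define wt where "wt k = S ^\<^sub>m k *\<^sub>v w0" for k
  define xt where "xt = rec_nat x0 (\<lambda>k x. A *\<^sub>v x + B *\<^sub>v u k + P *\<^sub>v wt k)"
  define yt where "yt k = C *\<^sub>v xt k + Q *\<^sub>v wt k" for k
  have wt_c: "wt k \<in> carrier_vec nw" for k
    unfolding wt_def by (rule mult_mat_vec_carrier[OF pow_carrier_mat[OF S] w0])
  have xt_c: "xt k \<in> carrier_vec n" for k
    unfolding xt_def by (cases k) (use x0 P in \<open>auto intro!: carrier_vecI\<close>)
  have yt_c: "yt k \<in> carrier_vec p" for k
    unfolding yt_def by (intro add_carrier_vec mult_mat_vec_carrier[OF C xt_c] mult_mat_vec_carrier[OF Q wt_c])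
  have wt_step: "wt (Suc k) = S *\<^sub>v wt k" for k
    unfolding wt_def pow_mat_Suc_left[OF S] by (rule assoc_mult_mat_vec[OF S pow_carrier_mat[OF S] w0])
  have xt_step: "xt (Suc k) = A *\<^sub>v xt k + B *\<^sub>v u k + P *\<^sub>v wt k" for k
    by (simp add: xt_def)
  let ?pd = "past_data p m l yt u"
  let ?Z1 = "Z1_mat A B C l OL" and ?Z2S = "Z2_mat A P C Q l OL * S_stack S l"
  note Z2S_c = mult_carrier_mat[OF Z2_mat_carrier[OF A P C OL_c Q] S_stack_carrier[OF S]]
  have out: "?Z1 *\<^sub>v ?pd k + ?Z2S *\<^sub>v wt k = yt k" if "l \<le> k" for k
    by (rule output_from_past_data[where u = u and w = wt and x = xt and y = yt, OF S A B P C Q OL_c OL(2) ev u wt_c xt_c wt_step xt_step yt_def that])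
  show "\<exists>xi0 \<in> carrier_vec ((p + m) * l).
       \<forall>w x chi y omega xi v phi :: nat \<Rightarrow> real vec.
         w 0 = w0 \<and> x 0 = x0 \<and> chi 0 = chi0 \<and>
         (\<forall>k. y k = C *\<^sub>v x k + Q *\<^sub>v w k) \<and>
         (\<forall>k. w (k + 1) = S *\<^sub>v w k) \<and>
         (\<forall>k. x (k + 1) = A *\<^sub>v x k + B *\<^sub>v u k + P *\<^sub>v w k) \<and>
         (\<forall>k. chi (k + 1) = F_mat p m l *\<^sub>v chi k + L_mat p m l *\<^sub>v y k + B_mat p m l *\<^sub>v u k) \<and>
         omega l = S ^\<^sub>m l *\<^sub>v w0 \<and> xi l = xi0 \<and>
         (\<forall>k\<ge>l. v k = u k) \<and>
         (\<forall>k\<ge>l. omega (k + 1) = S *\<^sub>v omega k) \<and>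
         (\<forall>k\<ge>l. xi (k + 1) =
            A_mat A B C l OL *\<^sub>v xi k + B_mat p m l *\<^sub>v v k
            + (L_mat p m l * Z2_mat A P C Q l OL * S_stack S l) *\<^sub>v omega k) \<and>
         (\<forall>k\<ge>l. phi k = ?Z1 *\<^sub>v xi k + ?Z2S *\<^sub>v omega k)
         \<longrightarrow>
         (\<forall>k\<ge>l. xi k = past_data p m l y u k \<and> past_data p m l y u k = chi k \<and> phi k = y k)"
  proof (intro bexI[of _ "?pd l"] allI impI, elim conjE)
    show "?pd l \<in> carrier_vec ((p + m) * l)" unfolding dims by (rule past_data_carrier)
  next
    fix w x chi y omega xi v phi :: "nat \<Rightarrow> real vec" and k
    assume init: "w 0 = w0" "x 0 = x0" "chi 0 = chi0" "omega l = S ^\<^sub>m l *\<^sub>v w0" "xi l = ?pd l"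
      and y: "\<forall>k. y k = C *\<^sub>v x k + Q *\<^sub>v w k"
      and w: "\<forall>k. w (k + 1) = S *\<^sub>v w k"
      and x: "\<forall>k. x (k + 1) = A *\<^sub>v x k + B *\<^sub>v u k + P *\<^sub>v w k"
      and chi: "\<forall>k. chi (k + 1) = F_mat p m l *\<^sub>v chi k + L_mat p m l *\<^sub>v y k + B_mat p m l *\<^sub>v u k"
      and v: "\<forall>k\<ge>l. v k = u k"
      and omega: "\<forall>k\<ge>l. omega (k + 1) = S *\<^sub>v omega k"
      and xi: "\<forall>k\<ge>l. xi (k + 1) =
            A_mat A B C l OL *\<^sub>v xi k + B_mat p m l *\<^sub>v v k
            + (L_mat p m l * Z2_mat A P C Q l OL * S_stack S l) *\<^sub>v omega k"
      and phi: "\<forall>k\<ge>l. phi k = ?Z1 *\<^sub>v xi k + ?Z2S *\<^sub>v omega k"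
      and k: "l \<le> k"
    have w_eq: "w k = wt k" for k
    proof (induction k)
      case 0
      show ?case using init(1) w0 S by (simp add: wt_def)
    next
      case (Suc k)
      then show ?case using w[rule_format, of k] by (simp add: wt_step)
    qed
    have x_eq: "x k = xt k" for k
    proof (induction k)
      case 0
      show ?case using init(2) by (simp add: xt_def)
    next
      case (Suc k)
      then show ?case using x[rule_format, of k] by (simp add: xt_step w_eq)
    qed
    have y_eq: "y = yt"
      using y by (intro ext) (simp add: yt_def w_eq x_eq)
    \<comment> \<open>The signals coincide with the constructed ones, so from here on \<open>yt\<close> stands for the output.\<close>
    have chi_eq: "chi k = ?pd k"
      by (rule shift_register_forgets_initial_state[OF _ yt_c u _ k])
         (use chi chi0 init(3) dims in \<open>auto simp: y_eq\<close>)
    have xi_omega: "xi k = ?pd k \<and> omega k = wt k"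
      using k
    proof (induction k rule: dec_induct)
      case base
      show ?case using init(4,5) by (simp add: wt_def)
    next
      case (step k)
      let ?F = "F_mat p m l" and ?L = "L_mat p m l" and ?b = "B_mat p m l *\<^sub>v u k"
      note Z1_c = Z1_mat_carrier[OF A B C OL_c] and Z2_c = Z2_mat_carrier[OF A P C OL_c Q]
      let ?z1 = "?Z1 *\<^sub>v ?pd k" and ?z2 = "?Z2S *\<^sub>v wt k"
      have z1: "?z1 \<in> carrier_vec p" by (rule mult_mat_vec_carrier[OF Z1_c past_data_carrier])
      have z2: "?z2 \<in> carrier_vec p" by (rule mult_mat_vec_carrier[OF Z2S_c wt_c])
      have A_pd: "A_mat A B C l OL *\<^sub>v ?pd k = ?F *\<^sub>v ?pd k + ?L *\<^sub>v ?z1"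
        unfolding A_mat_def carrier_matD(1)[OF C] carrier_matD(2)[OF B]
          assoc_mult_mat_vec[OF L_mat_carrier Z1_c past_data_carrier, symmetric]
        by (rule add_mult_distrib_mat_vec[OF F_mat_carrier
              mult_carrier_mat[OF L_mat_carrier Z1_c] past_data_carrier])
      have LZ2S: "(?L * Z2_mat A P C Q l OL * S_stack S l) *\<^sub>v wt k = ?L *\<^sub>v ?z2"
        unfolding assoc_mult_mat[OF L_mat_carrier Z2_c S_stack_carrier[OF S]]
        by (rule assoc_mult_mat_vec[OF L_mat_carrier Z2S_c wt_c])
      \<comment> \<open>The register of \<open>\<xi>\<close> is fed with the predicted output \<open>?z1 + ?z2\<close>, which \<open>out\<close> identifies
          with the true one.\<close>
      have "xi (Suc k) = (?F *\<^sub>v ?pd k + ?L *\<^sub>v ?z1) + ?b + ?L *\<^sub>v ?z2"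
        using xi step v by (simp add: A_pd LZ2S)
      also have "\<dots> = ?F *\<^sub>v ?pd k + (?L *\<^sub>v ?z1 + ?L *\<^sub>v ?z2) + ?b"
        by (rule eq_vecI) (use carrier_matD[OF F_mat_carrier] carrier_matD[OF L_mat_carrier]
            carrier_matD[OF B_mat_carrier] in auto)
      also have "?L *\<^sub>v ?z1 + ?L *\<^sub>v ?z2 = ?L *\<^sub>v (?z1 + ?z2)"
        by (rule mult_add_distrib_mat_vec[OF L_mat_carrier z1 z2, symmetric])
      also have "?z1 + ?z2 = yt k" by (rule out[OF step(1)])
      also have "?F *\<^sub>v ?pd k + ?L *\<^sub>v yt k + ?b = ?pd (Suc k)"
        by (rule past_data_Suc[OF yt_c u step(1)])
      finally have "xi (Suc k) = ?pd (Suc k)" .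
      moreover have "omega (Suc k) = wt (Suc k)"
        using omega step by (simp add: wt_step)
      ultimately show ?case by blast
    qed
    have "phi k = yt k" using phi k xi_omega out[OF k] by simp
    then show "xi k = past_data p m l y u k \<and> past_data p m l y u k = chi k \<and> phi k = y k"
      using xi_omega chi_eq by (simp add: y_eq)
  qed
qed

end
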